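(* Let $0<\mu<L$, let $f\in\mathcal{F}_{\mu,L}$ with minimum value $f_*$ and minimizer $x_*$, let $N\in\mathbb{N}$ and $x_0\in\mathbb{R}^n$. Set $y_0=x_0$, $\tilde\mu_{-1}=+\infty$, and for $k\ge0$ define $$y_{k+1}=x_k-\tfrac1L\nabla f(x_k),\qquad \tilde\mu_k=\min\left(\tilde\mu_{k-1},\frac{\|\nabla f(y_{k+1})\|^2}{2(f(y_{k+1})-f_* )}\right),$$ $$\beta_k=\frac{\sqrt L-\sqrt{\tilde\mu_k}}{\sqrt L+\sqrt{\tilde\mu_k}},\qquad x_{k+1}=y_{k+1}+\beta_k(y_{k+1}-y_k).$$ Suppose that $\tilde\mu_0,\dots,\tilde\mu_{N-1}$ are well defined (i.e. no denominator vanishes). Let $m$ be the first nonnegative integer such that $\frac{\|\nabla f(y_{m+1})\|^2}{2(f(y_{m+1})-f_* )}\le\sqrt{L\mu}$, with $m=\infty$ if this never happens during the $N$ iterations (i.e. for no $m\in\{0,\dots,N-1\}$). Then $$f(y_N)-f_*\le\begin{cases}\rho_1^{N}\left(\frac L2\left(\frac1{\sqrt{\rho_1}}-\sqrt{\rho_1}\right)^2\|x_0-x_*\|^2+f(x_0)-f_*\right)&\text{if } m=0,\\[2pt] \rho_2^{N}(f(x_0)-f_* )&\text{if } m=\infty,\\[2pt] C\,\rho_1^{N-m}\rho_2^{m}(f(x_0)-f_* )&\text{otherwise,}\end{cases}$$ where $\rho_1=\left(1+\left(\frac\mu L\right)^{3/4}\right)^{-1}$, $\rho_2=\left(1+\sqrt{\frac\mu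 L}\right)^{-1}$ and $C=\left(\frac1{\rho_1}-1\right)\left(1+\sqrt{\frac{L}{2\mu}}\right)^2+1$. Otherwise (if the $\tilde\mu_k$ are not all well defined), $\nabla f(y_k)=0$ for some $k\in\{0,\dots,N\}$.
   Context: $\|\cdot\|$ is the Euclidean norm on $\mathbb{R}^n$. $\mathcal{F}_{\mu,L}$ denotes the class of differentiable functions $f:\mathbb{R}^n\to\mathbb{R}$ that are $L$-smooth and $\mu$-strongly convex, i.e. for all $x,y\in\mathbb{R}^n$: $f(y)\le f(x)+\langle\nabla f(x),y-x\rangle+\frac L2\|y-x\|^2$ and $f(y)\ge f(x)+\langle\nabla f(x),y-x\rangle+\frac\mu2\|y-x\|^2$. *)

theory Defs
  imports "HOL-Analysis.Analysis"
begin

definition gradient :: "('a::real_inner \<Rightarrow> real) \<Rightarrow> 'a \<Rightarrow> 'a"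
  where "gradient f x = (THE D. GDERIV f x :> D)"

definition smooth_strongly_convex :: "real \<Rightarrow> real \<Rightarrow> (real ^ 'n \<Rightarrow> real) set"
  where "smooth_strongly_convex \<mu> L = {f.
    (\<forall>x. f differentiable (at x)) \<and>
    (\<forall>x y. f y \<le> f x + gradient f x \<bullet> (y - x) + L / 2 * (norm (y - x))\<^sup>2) \<and>
    (\<forall>x y. f y \<ge> f x + gradient f x \<bullet> (y - x) + \<mu> / 2 * (norm (y - x))\<^sup>2)}"

definition grad_gap_ratio :: "('a::real_inner \<Rightarrow> real) \<Rightarrow> real \<Rightarrow> 'a \<Rightarrow> real"
  where "grad_gap_ratio f f_star z = (norm (gradient f z))\<^sup>2 / (2 * (f z - f_star))"

(* Sequences x, y, the estimates mt (starting from plus infinity at index -1) and the momentum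
   coefficients. All functions being total, the recursion runs on with x / 0 = 0 after a vanishing
   denominator; the values of mt at k are meaningful only if f (y (Suc i)) \<noteq> f_star for all i \<le> k,
   see estimate_defined. *)
definition adaptive_momentum_run ::
    "real \<Rightarrow> ('a::real_inner \<Rightarrow> real) \<Rightarrow> real \<Rightarrow> 'a \<Rightarrow>
     (nat \<Rightarrow> 'a) \<Rightarrow> (nat \<Rightarrow> 'a) \<Rightarrow> (nat \<Rightarrow> ereal) \<Rightarrow> (nat \<Rightarrow> real) \<Rightarrow> bool"
  where "adaptive_momentum_run L f f_star x0 x y mt \<beta> \<longleftrightarrow>
    x 0 = x0 \<and> y 0 = x0 \<and>
    (\<forall>k. y (Suc k) = x k - (1 / L) *\<^sub>R gradient f (x k)) \<and>
    (\<forall>k. mt k = min (case k of 0 \<Rightarrow> \<infinity> | Suc j \<Rightarrow> mt j)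
                    (ereal (grad_gap_ratio f f_star (y (Suc k))))) \<and>
    (\<forall>k. \<beta> k = (sqrt L - sqrt (real_of_ereal (mt k))) / (sqrt L + sqrt (real_of_ereal (mt k)))) \<and>
    (\<forall>k. x (Suc k) = y (Suc k) + \<beta> k *\<^sub>R (y (Suc k) - y k))"

definition estimate_defined :: "('a \<Rightarrow> real) \<Rightarrow> real \<Rightarrow> (nat \<Rightarrow> 'a) \<Rightarrow> nat \<Rightarrow> bool"
  where "estimate_defined f f_star y k \<longleftrightarrow> (\<forall>i\<le>k. 2 * (f (y (Suc i)) - f_star) \<noteq> 0)"

definition switch_index ::
    "real \<Rightarrow> real \<Rightarrow> ('a::real_inner \<Rightarrow> real) \<Rightarrow> real \<Rightarrow> (nat \<Rightarrow> 'a) \<Rightarrow> nat \<Rightarrow> enat"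
  where "switch_index \<mu> L f f_star y N =
    (if \<exists>k<N. grad_gap_ratio f f_star (y (Suc k)) \<le> sqrt (L * \<mu>)
     then enat (LEAST k. grad_gap_ratio f f_star (y (Suc k)) \<le> sqrt (L * \<mu>))
     else \<infinity>)"

definition rho1 :: "real \<Rightarrow> real \<Rightarrow> real"
  where "rho1 \<mu> L = inverse (1 + (\<mu> / L) powr (3 / 4))"

definition rho2 :: "real \<Rightarrow> real \<Rightarrow> real"
  where "rho2 \<mu> L = inverse (1 + sqrt (\<mu> / L))"

definition switch_const :: "real \<Rightarrow> real \<Rightarrow> real"
  where "switch_const \<mu> L = (1 / rho1 \<mu> L - 1) * (1 + sqrt (L / (2 * \<mu>)))\<^sup>2 + 1"

end

theory Submission
  imports Defs
begin

text \<open>Put \<open>q = (\<mu>/L)\<^sup>1\<^sup>/\<^sup>4\<close>, so that \<open>\<rho>\<^sub>1 = 1/(1 + q\<^sup>3)\<close> and \<open>\<rho>\<^sub>2 = 1/(1 + q\<^sup>2)\<close>, and \<open>F = f - f\<^sub>*\<close>.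
  While the ratio exceeds \<open>\<surd>(L\<mu>) = q\<^sup>2 L\<close>, cocoercivity of the gradient makes the energy
  \<open>F(y\<^sub>k) + L/2 |x\<^sub>k - y\<^sub>k|\<^sup>2\<close> decrease by the factor \<open>\<rho>\<^sub>2\<close>. Afterwards the momentum coefficient lies
  between \<open>(1 - q)/(1 + q)\<close> and \<open>(1 - q\<^sup>2)/(1 + q\<^sup>2)\<close>, and with \<open>s = q\<^sup>3\<close> the energy
  \<open>(1 + s) F(y\<^sub>k) + L/(2(1 + s)) |(y\<^sub>k - y\<^sub>k\<^sub>-\<^sub>1) + s (y\<^sub>k - x\<^sub>*)|\<^sup>2\<close> decreases by the factor \<open>\<rho>\<^sub>1\<close>,
  whatever coefficients are chosen in that range: this is the positivity of a quadratic form in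
  \<open>y\<^sub>k - y\<^sub>k\<^sub>-\<^sub>1\<close> and \<open>y\<^sub>k - x\<^sub>*\<close>. Of the gradient only the two inequalities defining the
  function class are used.\<close>

section \<open>Concave quadratics, quadratic forms and the momentum determinant\<close>

text \<open>A concave quadratic lies above its chord: \<open>b - a\<close> times the value at
  \<open>t\<close> is a weighted sum of the end values plus the surplus
  \<open>c2 * ((b - a) * (t - a) * (b - t))\<close>.\<close>

lemma concave_quadratic_nonneg:
  fixes a b t c0 c1 c2 :: real
  assumes "a < b" "a \<le> t" "t \<le> b" "0 \<le> c2"
    and "0 \<le> c0 + c1 * a - c2 * a\<^sup>2" "0 \<le> c0 + c1 * b - c2 * b\<^sup>2"
  shows "0 \<le> c0 + c1 * t - c2 * t\<^sup>2"
proof -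
  have "(b - a) * (c0 + c1 * t - c2 * t\<^sup>2) =
      (b - t) * (c0 + c1 * a - c2 * a\<^sup>2) + (t - a) * (c0 + c1 * b - c2 * b\<^sup>2)
      + c2 * ((b - a) * (t - a) * (b - t))"
    by algebra
  also have "\<dots> \<ge> 0"
    using assms by (intro add_nonneg_nonneg mult_nonneg_nonneg) auto
  finally show ?thesis
    using \<open>a < b\<close> by (simp add: zero_le_mult_iff)
qed

text \<open>Completing the square: \<open>C\<close> times the form is the squared norm of
  \<open>B *\<^sub>R d + C *\<^sub>R p\<close> plus
  \<open>(A * C - B\<^sup>2) * (d \<bullet> d)\<close>.\<close>

lemma quadratic_form_nonneg:
  fixes d p :: "'a::real_inner" and A B C :: real
  assumes "0 < C" "B\<^sup>2 \<le> A * C"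
  shows "0 \<le> A * (d \<bullet> d) + 2 * B * (d \<bullet> p) + C * (p \<bullet> p)"
proof -
  have "0 \<le> (B *\<^sub>R d + C *\<^sub>R p) \<bullet> (B *\<^sub>R d + C *\<^sub>R p) + (A * C - B\<^sup>2) * (d \<bullet> d)"
    using assms by simp
  also have "\<dots> = C * (A * (d \<bullet> d) + 2 * B * (d \<bullet> p) + C * (p \<bullet> p))"
    by (simp add: inner_simps inner_commute algebra_simps power2_eq_square)
  finally show ?thesis
    using \<open>0 < C\<close> by (simp add: zero_le_mult_iff)
qed

lemma momentum_coeff_antimono:
  fixes a b :: real
  assumes "0 \<le> a" "a \<le> b"
  shows "(1 - b) / (1 + b) \<le> (1 - a) / (1 + a)"
  using assms by (simp add: divide_simps algebra_simps)

text \<open>Up to the factor \<open>q\<^sup>6\<close>, the determinant of the quadratic form (scaled by \<open>(1 + q\<^sup>3)\<^sup>2\<close>) behind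
  \<open>momentum_form_bound\<close>.\<close>

definition momentum_det :: "real \<Rightarrow> real \<Rightarrow> real" where
  "momentum_det q t =
    q * ((1 + q^3)\<^sup>2 - q\<^sup>2) * (1 - (1 + q^3)\<^sup>2 * (1 + q^3 - q^7) * t\<^sup>2)
    - (1 - (1 + q^3)\<^sup>2 * (1 - q^4) * t)\<^sup>2"

text \<open>Clears the denominator when \<open>t\<close> is a quotient over \<open>n\<close>; used
  with \<open>n\<close> equal to \<open>1 + q\<close> and \<open>1 + q\<^sup>2\<close>.\<close>

lemma momentum_det_scaled:
  "(n\<^sup>2) * momentum_det q t =
    q * ((1 + q^3)\<^sup>2 - q\<^sup>2) * (n\<^sup>2 - (1 + q^3)\<^sup>2 * (1 + q^3 - q^7) * (n * t)\<^sup>2)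
    - (n - (1 + q^3)\<^sup>2 * (1 - q^4) * (n * t))\<^sup>2"
  unfolding momentum_det_def by algebra

lemma momentum_det_lower:
  assumes "0 < q" "q < 1"
  shows "0 \<le> momentum_det q ((1 - q) / (1 + q))"
proof -
  have pow: "q ^ i \<le> q ^ j" if "j \<le> i" for i j
    using assms that by (simp add: power_decreasing)
  have "(1 + q)\<^sup>2 * momentum_det q ((1 - q) / (1 + q)) =
      q * ((1 + q^3)\<^sup>2 - q\<^sup>2) * ((1 + q)\<^sup>2 - (1 + q^3)\<^sup>2 * (1 + q^3 - q^7) * (1 - q)\<^sup>2)
      - ((1 + q) - (1 + q^3)\<^sup>2 * (1 - q^4) * (1 - q))\<^sup>2"
    unfolding momentum_det_scaled using assms by simp
  also have "\<dots> = q^4 * (1 + 2 * q + q^3 + q^4 + 2 * q^5 + q^6 - 3 * q^7 + 3 * q^8 + q^9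
      - 2 * q^10 + q^11)"
    by algebra
  also have "\<dots> \<ge> 0"
  proof (intro mult_nonneg_nonneg)
    \<comment> \<open>The negative terms are absorbed by lower powers: \<open>3 * q^7\<close> by
      \<open>2 * q + q^3\<close>, and \<open>2 * q^10\<close> by \<open>3 * q^8\<close>.\<close>
    have "q^7 \<le> q" "q^7 \<le> q^3" "q^10 \<le> q^8"
      using pow[of 1 7] pow[of 3 7] pow[of 8 10] by simp_all
    moreover have "0 \<le> q^i" for i using assms by simp
    note this[of 4] this[of 5] this[of 6] this[of 8] this[of 9] this[of 11]
    ultimately show "0 \<le> 1 + 2 * q + q^3 + q^4 + 2 * q^5 + q^6 - 3 * q^7 + 3 * q^8 + q^9
        - 2 * q^10 + q^11"
      by linarith
  qed (use assms in simp)
  finally show ?thesis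
    using assms by (simp add: zero_le_mult_iff)
qed

lemma momentum_det_upper:
  assumes "0 < q" "q < 1"
  shows "0 \<le> momentum_det q ((1 - q\<^sup>2) / (1 + q\<^sup>2))"
proof -
  have pow: "q ^ i \<le> q ^ j" if "j \<le> i" for i j
    using assms that by (simp add: power_decreasing)
  have ne: "1 + q\<^sup>2 > 0" using assms by (simp add: add_pos_pos)
  have "(1 + q\<^sup>2)\<^sup>2 * momentum_det q ((1 - q\<^sup>2) / (1 + q\<^sup>2)) =
      q * ((1 + q^3)\<^sup>2 - q\<^sup>2) * ((1 + q\<^sup>2)\<^sup>2 - (1 + q^3)\<^sup>2 * (1 + q^3 - q^7) * (1 - q\<^sup>2)\<^sup>2)
      - ((1 + q\<^sup>2) - (1 + q^3)\<^sup>2 * (1 - q^4) * (1 - q\<^sup>2))\<^sup>2"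
    unfolding momentum_det_scaled using ne by simp
  \<comment> \<open>The expanded polynomial is regrouped into squares and differences of powers. The
    fractions come from 7 q^2 - 13 q + 9 = 7 (q - 13/14)^2 + 83/28.\<close>
  also have "\<dots> = q^3 * (4 * (1 - q)\<^sup>2 + q
      + q^3 * (7 * (q - 13 / 14)\<^sup>2 + 83 / 28)
      + q^6 * (3 * (1 - q)\<^sup>2 + 2 * q\<^sup>2) + 2 * (q^6 - q^9) + (q^11 + 2 * (q^11 - q^12)) + q^14)"
    by (simp add: power2_eq_square algebra_simps power_numeral_reduce)
  also have "\<dots> \<ge> 0"
    using assms pow[of 6 9] pow[of 11 12]
    by (intro mult_nonneg_nonneg add_nonneg_nonneg) auto
  finally show ?thesis
    using ne by (simp add: zero_le_mult_iff)
qed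

text \<open>As a function of \<open>t\<close> the determinant is a concave quadratic, so the two extreme momentum
  coefficients decide.\<close>

lemma momentum_det_nonneg:
  assumes q: "0 < q" "q < 1"
    and t: "(1 - q) / (1 + q) \<le> t" "t \<le> (1 - q\<^sup>2) / (1 + q\<^sup>2)"
  shows "0 \<le> momentum_det q t"
proof -
  let ?G = "(1 + q^3)\<^sup>2 - q\<^sup>2" and ?K = "1 + q^3 - q^7" and ?R = "(1 + q^3)\<^sup>2"
  have eq: "momentum_det q t = (q * ?G - 1) + (2 * ?R * (1 - q^4)) * t
      - (q * ?G * ?R * ?K + (?R * (1 - q^4))\<^sup>2) * t\<^sup>2" for t
    unfolding momentum_det_def by algebra
  have "q\<^sup>2 \<le> 1\<^sup>2" "q ^ 7 \<le> 1"
    using q by (simp_all add: power_le_one)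
  moreover have "1\<^sup>2 \<le> (1 + q^3)\<^sup>2" using q by (intro power_mono) auto
  ultimately have "0 \<le> ?G" "0 \<le> ?K" using q by (auto simp: add_increasing2)
  then have c2: "0 \<le> q * ?G * ?R * ?K + (?R * (1 - q^4))\<^sup>2"
    using q by (intro add_nonneg_nonneg mult_nonneg_nonneg) auto
  have "q\<^sup>2 < q" using q by (simp add: power2_eq_square)
  then have lt: "(1 - q) / (1 + q) < (1 - q\<^sup>2) / (1 + q\<^sup>2)"
    using q by (simp add: divide_simps algebra_simps add_pos_pos power2_eq_square)
  show ?thesis
    unfolding eq
    by (rule concave_quadratic_nonneg[OF lt t c2])
      (use momentum_det_lower[OF q] momentum_det_upper[OF q] in \<open>simp_all only: eq\<close>)
qed

text \<open>Multiplied by \<open>(1 + q^3)\<^sup>2\<close>, the right side minus the left side is a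
  quadratic form in \<open>d\<close> and \<open>p\<close> with determinant
  \<open>q^6 * momentum_det q t\<close>. In the run \<open>d\<close> is the last step and
  \<open>p\<close> the displacement from the minimizer; the subtracted term is the gain from strong
  convexity.\<close>

lemma momentum_form_bound:
  fixes d p :: "'a::real_inner" and q t :: real
  assumes q: "0 < q" "q < 1"
    and t: "(1 - q) / (1 + q) \<le> t" "t \<le> (1 - q\<^sup>2) / (1 + q\<^sup>2)"
  shows "(norm (t *\<^sub>R d + q^3 *\<^sub>R (p + t *\<^sub>R d)))\<^sup>2 / (1 + q^3)
      - q^3 * q^4 * (norm (p + t *\<^sub>R d))\<^sup>2
    \<le> (norm (d + q^3 *\<^sub>R p))\<^sup>2 / (1 + q^3)\<^sup>2"
proof -
  define s where "s = q ^ 3"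
  define A where "A = 1 - (1 + s)\<^sup>2 * (1 + s - s * q^4) * t\<^sup>2"
  define B where "B = s * (1 - (1 + s)\<^sup>2 * (1 - q^4) * t)"
  define C where "C = s * q^4 * (1 + s)\<^sup>2 - s^3"
  have s: "0 < s" using q by (simp add: s_def)
  have C: "C = q^7 * ((1 + q^3)\<^sup>2 - q\<^sup>2)"
    unfolding C_def s_def by algebra
  have "q\<^sup>2 < 1" using q by (simp add: power_less_one_iff)
  moreover have "1\<^sup>2 \<le> (1 + q^3)\<^sup>2" using q by (intro power_mono) auto
  ultimately have "q\<^sup>2 < (1 + q^3)\<^sup>2" by simp
  then have "0 < C" unfolding C using q by simp
  have "B\<^sup>2 \<le> A * C"
  proof -
    have "A * C - B\<^sup>2 = q^6 * momentum_det q t"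
      unfolding C A_def B_def s_def momentum_det_def by algebra
    then show ?thesis
      using momentum_det_nonneg[OF q t] q by (metis diff_ge_0_iff_ge less_imp_le mult_nonneg_nonneg zero_le_power)
  qed
  with \<open>0 < C\<close> have "0 \<le> A * (d \<bullet> d) + 2 * B * (d \<bullet> p) + C * (p \<bullet> p)"
    by (rule quadratic_form_nonneg)
  also have "\<dots> = (norm (d + s *\<^sub>R p))\<^sup>2
      - (1 + s) * (norm (t *\<^sub>R d + s *\<^sub>R (p + t *\<^sub>R d)))\<^sup>2
      + (1 + s)\<^sup>2 * (s * q^4 * (norm (p + t *\<^sub>R d))\<^sup>2)"
    unfolding A_def B_def C_def power2_norm_eq_inner
    by (simp add: inner_simps inner_commute[of p d]) algebra
  finally have "(1 + s) * (norm (t *\<^sub>R d + s *\<^sub>R (p + t *\<^sub>R d)))\<^sup>2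
      - (1 + s)\<^sup>2 * (s * q^4 * (norm (p + t *\<^sub>R d))\<^sup>2) \<le> (norm (d + s *\<^sub>R p))\<^sup>2"
    by simp
  then have "((1 + s) * (norm (t *\<^sub>R d + s *\<^sub>R (p + t *\<^sub>R d)))\<^sup>2
      - (1 + s)\<^sup>2 * (s * q^4 * (norm (p + t *\<^sub>R d))\<^sup>2)) / (1 + s)\<^sup>2
      \<le> (norm (d + s *\<^sub>R p))\<^sup>2 / (1 + s)\<^sup>2"
    by (rule divide_right_mono) simp
  also have "((1 + s) * (norm (t *\<^sub>R d + s *\<^sub>R (p + t *\<^sub>R d)))\<^sup>2
      - (1 + s)\<^sup>2 * (s * q^4 * (norm (p + t *\<^sub>R d))\<^sup>2)) / (1 + s)\<^sup>2 =
      (norm (t *\<^sub>R d + s *\<^sub>R (p + t *\<^sub>R d)))\<^sup>2 / (1 + s) - s * q^4 * (norm (p + t *\<^sub>R d))\<^sup>2"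
    using s by (simp add: diff_divide_distrib power2_eq_square)
  finally show ?thesis by (simp add: s_def)
qed

section \<open>Consequences of smoothness and strong convexity\<close>

locale smooth_convex_gradient =
  fixes f :: "'a::real_inner \<Rightarrow> real" and g :: "'a \<Rightarrow> 'a" and \<mu> L :: real and xs :: 'a
  assumes mu_pos: "0 < \<mu>" and mu_less: "\<mu> < L"
    and upper: "f y \<le> f x + g x \<bullet> (y - x) + L / 2 * (norm (y - x))\<^sup>2"
    and lower: "f y \<ge> f x + g x \<bullet> (y - x) + \<mu> / 2 * (norm (y - x))\<^sup>2"
    and minimum: "f xs \<le> f x"
begin

lemma L_pos: "0 < L"
  using mu_pos mu_less by simp

lemma descent: "f (x - (1 / L) *\<^sub>R g x) + (norm (g x))\<^sup>2 / (2 * L) \<le> f x"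
proof -
  have "L / 2 * (norm (x - (1 / L) *\<^sub>R g x - x))\<^sup>2 = (norm (g x))\<^sup>2 / (2 * L)"
    using L_pos by (simp add: power2_eq_square)
  moreover have "g x \<bullet> (x - (1 / L) *\<^sub>R g x - x) = - 2 * ((norm (g x))\<^sup>2 / (2 * L))"
    using L_pos by (simp add: power2_norm_eq_inner)
  ultimately show ?thesis
    using upper[of "x - (1 / L) *\<^sub>R g x" x] by linarith
qed

text \<open>A gradient step cannot pass below the minimum. This bounds the ratio by \<open>L\<close>
  and makes the gradient vanish wherever the gap does.\<close>

lemma grad_sq_le_gap: "(norm (g x))\<^sup>2 \<le> 2 * L * (f x - f xs)"
proof -
  have "(norm (g x))\<^sup>2 / (2 * L) \<le> f x - f xs"
    using descent[of x] minimum[of "x - (1 / L) *\<^sub>R g x"] by linarith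
  then show ?thesis
    using L_pos by (simp add: field_simps)
qed

text \<open>The Polyak-Lojasiewicz inequality, by completing the square in the strong convexity
  bound at \<open>xs\<close>. It keeps the ratio at least \<open>\<mu>\<close>.\<close>

lemma gap_le_grad_sq: "2 * \<mu> * (f x - f xs) \<le> (norm (g x))\<^sup>2"
proof -
  have "0 \<le> (norm (g x + \<mu> *\<^sub>R (xs - x)))\<^sup>2" by simp
  also have "\<dots> = (norm (g x))\<^sup>2 + 2 * \<mu> * (g x \<bullet> (xs - x) + \<mu> / 2 * (norm (xs - x))\<^sup>2)"
    unfolding power2_norm_eq_inner
    by (simp add: inner_add_left inner_add_right inner_commute[of "xs - x" "g x"] distrib_left power2_eq_square del: inner_diff_left inner_diff_right)
  also have "\<dots> \<le> (norm (g x))\<^sup>2 + 2 * \<mu> * (f xs - f x)"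
    using lower[of x xs] mu_pos by (intro add_left_mono mult_left_mono) auto
  finally show ?thesis by (simp add: algebra_simps)
qed

text \<open>The gradient at the minimizer vanishes by \<open>grad_sq_le_gap\<close>, so
  \<open>lower\<close> has no linear term there.\<close>

lemma quadratic_growth: "\<mu> / 2 * (norm (x - xs))\<^sup>2 \<le> f x - f xs"
  using lower[of xs x] grad_sq_le_gap[of xs] by simp

lemma convex: "f x + g x \<bullet> (y - x) \<le> f y"
proof -
  have "0 \<le> \<mu> / 2 * (norm (y - x))\<^sup>2" using mu_pos by simp
  then show ?thesis using lower[of x y] by linarith
qed

text \<open>At the point \<open>x - (1 / L) *\<^sub>R (g x - g y)\<close> the convex lower bound
  from \<open>y\<close> is compared with the smooth upper bound from \<open>x\<close>.\<close>

lemma cocoercive: "f y + g y \<bullet> (x - y) + (norm (g x - g y))\<^sup>2 / (2 * L) \<le> f x"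
proof -
  define w where "w = g x - g y"
  have "f y + g y \<bullet> (x - (1 / L) *\<^sub>R w - y) \<le> f (x - (1 / L) *\<^sub>R w)"
    by (rule convex)
  also have "\<dots> \<le> f x - (1 / L) * (g x \<bullet> w) + (w \<bullet> w) / (2 * L)"
  proof -
    have "L / 2 * (norm (x - (1 / L) *\<^sub>R w - x))\<^sup>2 = (w \<bullet> w) / (2 * L)"
      using L_pos by (simp add: power2_eq_square flip: power2_norm_eq_inner)
    then show ?thesis
      using upper[of "x - (1 / L) *\<^sub>R w" x] by simp
  qed
  finally have "f y + g y \<bullet> (x - y) + (1 / L) * ((g x - g y) \<bullet> w) - (w \<bullet> w) / (2 * L) \<le> f x"
    by (simp add: inner_simps algebra_simps diff_divide_distrib)
  then show ?thesis
    using L_pos by (simp add: power2_norm_eq_inner flip: w_def)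
qed

text \<open>Cocoercivity between \<open>x\<close> and \<open>y'\<close>: since \<open>x - y'\<close>
  is \<open>g x\<close> divided by \<open>L\<close>, the mixed inner products cancel and both
  squared gradients remain as gain.\<close>

lemma gradient_step:
  assumes "y' = x - (1 / L) *\<^sub>R g x"
  shows "f y' + (norm (g y'))\<^sup>2 / (2 * L) + (norm (g x))\<^sup>2 / (2 * L) \<le> f x"
proof -
  have d: "x - y' = (1 / L) *\<^sub>R g x" using assms by simp
  have "g y' \<bullet> (x - y') + (norm (g x - g y'))\<^sup>2 / (2 * L)
      = (norm (g y'))\<^sup>2 / (2 * L) + (norm (g x))\<^sup>2 / (2 * L)"
    unfolding d power2_norm_eq_inner using L_pos
    by (simp add: inner_diff_left inner_diff_right inner_commute[of "g y'" "g x"] field_simps)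
  then show ?thesis
    using cocoercive[of y' x] by linarith
qed

section \<open>Energy decrease in a single step\<close>

text \<open>The gain at \<open>y'\<close> from \<open>gradient_step\<close> is converted by the
  ratio into \<open>c\<close> times the gap. The gain at \<open>x\<close> and the inner product from
  convexity are exactly what expanding the squared distance from \<open>y'\<close> to
  \<open>y\<close> requires.\<close>

lemma step_fast:
  assumes y': "y' = x - (1 / L) *\<^sub>R g x"
    and ratio: "2 * (c * L) * (f y' - f xs) \<le> (norm (g y'))\<^sup>2"
  shows "(1 + c) * (f y' - f xs) + L / 2 * (norm (y' - y))\<^sup>2
    \<le> f y - f xs + L / 2 * (norm (x - y))\<^sup>2"
proof -
  have "c * (f y' - f xs) \<le> (norm (g y'))\<^sup>2 / (2 * L)"
    using ratio L_pos by (simp add: field_simps)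
  moreover have "f x + g x \<bullet> (y - x) \<le> f y" by (rule convex)
  moreover have "L / 2 * (norm (y' - y))\<^sup>2 =
      L / 2 * (norm (x - y))\<^sup>2 + g x \<bullet> (y - x) + (norm (g x))\<^sup>2 / (2 * L)"
    unfolding y' power2_norm_eq_inner using L_pos
    by (simp add: inner_simps inner_commute[of x "g x"] inner_commute[of y "g x"] field_simps)
  ultimately show ?thesis
    using gradient_step[OF y'] by (simp add: algebra_simps)
qed

text \<open>The convexity inequalities at \<open>x\<close> against \<open>y\<close> (weight 1) and against the minimizer
  (weight \<open>s\<close>), after completing the square in the gradient.\<close>

lemma step_mixed:
  assumes y': "y' = x - (1 / L) *\<^sub>R g x" and s: "0 \<le> s"
  shows "(1 + s) * (f y' - f xs) + L / (2 * (1 + s)) * (norm ((y' - y) + s *\<^sub>R (y' - xs)))\<^sup>2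
    \<le> f y - f xs + L / (2 * (1 + s)) * (norm ((x - y) + s *\<^sub>R (x - xs)))\<^sup>2
      - s * (\<mu> / 2 * (norm (x - xs))\<^sup>2)"
proof -
  define v where "v = (x - y) + s *\<^sub>R (x - xs)"
  have w: "(y' - y) + s *\<^sub>R (y' - xs) = v - ((1 + s) / L) *\<^sub>R g x"
    unfolding v_def y' by (simp add: algebra_simps add_divide_distrib)
  have sq_diff: "(norm (v - c *\<^sub>R g x))\<^sup>2 = (norm v)\<^sup>2 - 2 * c * (g x \<bullet> v) + c\<^sup>2 * (norm (g x))\<^sup>2" for c
    unfolding power2_norm_eq_inner
    by (simp add: inner_diff_left inner_diff_right inner_commute[of v "g x"] power2_eq_square
        right_diff_distrib)
  have "L / (2 * (1 + s)) * (norm ((y' - y) + s *\<^sub>R (y' - xs)))\<^sup>2 =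
      L / (2 * (1 + s)) * ((norm v)\<^sup>2 - 2 * ((1 + s) / L) * (g x \<bullet> v)
        + ((1 + s) / L)\<^sup>2 * (norm (g x))\<^sup>2)"
    unfolding w sq_diff ..
  also have "\<dots> = L / (2 * (1 + s)) * (norm v)\<^sup>2 - g x \<bullet> v + (1 + s) * ((norm (g x))\<^sup>2 / (2 * L))"
  proof -
    have "L / (2 * r) * (2 * (r / L)) = 1" "L / (2 * r) * (r / L)\<^sup>2 = r / (2 * L)" if "r \<noteq> 0" for r
      using L_pos that by (simp_all add: power2_eq_square)
    from this[of "1 + s"] s show ?thesis
      by (simp only: distrib_left right_diff_distrib mult.assoc[symmetric]) simp
  qed
  finally have sq: "L / (2 * (1 + s)) * (norm ((y' - y) + s *\<^sub>R (y' - xs)))\<^sup>2 = \<dots>" .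
  \<comment> \<open>Descent carries the total weight \<open>1 + s\<close>, which matches the squared
    gradient left in \<open>sq\<close>; the inner products in the next two inequalities add up to
    that of \<open>g x\<close> with \<open>v\<close>.\<close>
  have "(1 + s) * (f y' + (norm (g x))\<^sup>2 / (2 * L)) \<le> (1 + s) * f x"
    using descent[of x] s unfolding y' by (intro mult_left_mono) auto
  moreover have "f x - g x \<bullet> (x - y) \<le> f y"
    using convex[of x y] by (simp add: inner_diff_right algebra_simps)
  moreover have "s * (f x - g x \<bullet> (x - xs) + \<mu> / 2 * (norm (x - xs))\<^sup>2) \<le> s * f xs"
    using lower[of x xs] s by (intro mult_left_mono) (auto simp: inner_diff_right norm_minus_commute)
  ultimately show ?thesis
    unfolding sq unfolding v_def
    by (simp add: inner_add_right algebra_simps)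
qed

section \<open>Energy decay along the two phases\<close>

text \<open>\<open>step_fast\<close> gives the factor \<open>1 + c\<close> on the gap, and the bound
  on \<open>\<beta> k\<close> gives it on the squared norm of \<open>x (Suc k) - y (Suc k)\<close>.
  The energy starts as the bare gap because \<open>x 0 = y 0\<close>.\<close>

lemma fast_phase:
  assumes c: "0 \<le> c" and init: "x 0 = y 0"
    and y: "\<And>k. y (Suc k) = x k - (1 / L) *\<^sub>R g (x k)"
    and x: "\<And>k. x (Suc k) = y (Suc k) + \<beta> k *\<^sub>R (y (Suc k) - y k)"
    and ratio: "\<And>k. k < m \<Longrightarrow> 2 * (c * L) * (f (y (Suc k)) - f xs) \<le> (norm (g (y (Suc k))))\<^sup>2"
    and \<beta>: "\<And>k. k < m \<Longrightarrow> (\<beta> k)\<^sup>2 \<le> 1 / (1 + c)"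
  shows "(1 + c) ^ m * (f (y m) - f xs + L / 2 * (norm (x m - y m))\<^sup>2) \<le> f (y 0) - f xs"
  using ratio \<beta>
proof (induction m)
  case 0
  then show ?case by (simp add: init)
next
  case (Suc m)
  let ?E = "\<lambda>k. f (y k) - f xs + L / 2 * (norm (x k - y k))\<^sup>2"
  have "(norm (x (Suc m) - y (Suc m)))\<^sup>2 = (\<beta> m)\<^sup>2 * (norm (y (Suc m) - y m))\<^sup>2"
    by (simp add: x power_mult_distrib)
  also have "\<dots> \<le> 1 / (1 + c) * (norm (y (Suc m) - y m))\<^sup>2"
    using Suc.prems(2)[of m] by (intro mult_right_mono) auto
  finally have "(1 + c) * (norm (x (Suc m) - y (Suc m)))\<^sup>2 \<le> (norm (y (Suc m) - y m))\<^sup>2"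
    using c by (simp add: field_simps)
  then have "L / 2 * ((1 + c) * (norm (x (Suc m) - y (Suc m)))\<^sup>2)
      \<le> L / 2 * (norm (y (Suc m) - y m))\<^sup>2"
    using L_pos by (intro mult_left_mono) auto
  moreover have "(1 + c) * (f (y (Suc m)) - f xs) + L / 2 * (norm (y (Suc m) - y m))\<^sup>2 \<le> ?E m"
    by (rule step_fast[OF y Suc.prems(1)]) simp
  ultimately have "(1 + c) * ?E (Suc m) \<le> ?E m"
    by (simp add: algebra_simps add_divide_distrib)
  then have "(1 + c) ^ m * ((1 + c) * ?E (Suc m)) \<le> (1 + c) ^ m * ?E m"
    using c by (intro mult_left_mono) auto
  also have "\<dots> \<le> f (y 0) - f xs"
    using Suc.prems by (intro Suc.IH) auto
  finally show ?case by (simp add: mult_ac)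
qed

lemma slow_phase:
  assumes q: "0 < q" "q < 1" "\<mu> = q^4 * L" and "m < n"
    and y: "\<And>k. y (Suc k) = x k - (1 / L) *\<^sub>R g (x k)"
    and x: "\<And>k. x (Suc k) = y (Suc k) + \<beta> k *\<^sub>R (y (Suc k) - y k)"
    and \<beta>: "\<And>k. m \<le> k \<Longrightarrow> k < n \<Longrightarrow> (1 - q) / (1 + q) \<le> \<beta> k \<and> \<beta> k \<le> (1 - q\<^sup>2) / (1 + q\<^sup>2)"
  shows "(1 + q^3) ^ (n - m) * (f (y n) - f xs) \<le> f (y m) - f xs
    + L / (2 * (1 + q^3)) * (norm ((x m - y m) + q^3 *\<^sub>R (x m - xs)))\<^sup>2"
proof -
  define s where "s = q^3"
  have s: "0 < s" using q by (simp add: s_def)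
  define \<Phi> where "\<Phi> k = (1 + s) * (f (y (Suc k)) - f xs)
    + L / (2 * (1 + s)) * (norm ((y (Suc k) - y k) + s *\<^sub>R (y (Suc k) - xs)))\<^sup>2" for k
  let ?B = "f (y m) - f xs + L / (2 * (1 + s)) * (norm ((x m - y m) + s *\<^sub>R (x m - xs)))\<^sup>2"
  note mixed = step_mixed[OF y less_imp_le[OF s], folded \<Phi>_def]
  have "(1 + s) * \<Phi> (Suc k) \<le> \<Phi> k" if k: "m \<le> k" "k < n" for k
  proof -
    define d where "d = y (Suc k) - y k"
    define p where "p = y (Suc k) - xs"
    define t where "t = \<beta> k"
    have e: "x (Suc k) - y (Suc k) = t *\<^sub>R d" "x (Suc k) - xs = p + t *\<^sub>R d"
      by (simp_all add: x d_def p_def t_def)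
    \<comment> \<open>As \<open>q^4 * L\<close> is \<open>\<mu>\<close>, the subtracted term is the
      strong convexity gain left over by \<open>step_mixed\<close>; what remains on the right is the
      norm term of \<open>\<Phi> k\<close> divided by \<open>1 + s\<close>.\<close>
    have "L / 2 * ((norm (t *\<^sub>R d + s *\<^sub>R (p + t *\<^sub>R d)))\<^sup>2 / (1 + s)
        - s * q^4 * (norm (p + t *\<^sub>R d))\<^sup>2) \<le> L / 2 * ((norm (d + s *\<^sub>R p))\<^sup>2 / (1 + s)\<^sup>2)"
      unfolding s_def t_def using \<beta>[OF k] L_pos q
      by (intro mult_left_mono momentum_form_bound) auto
    then have "L / (2 * (1 + s)) * (norm (t *\<^sub>R d + s *\<^sub>R (p + t *\<^sub>R d)))\<^sup>2
        - s * (\<mu> / 2 * (norm (p + t *\<^sub>R d))\<^sup>2)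
        \<le> L / (2 * (1 + s)\<^sup>2) * (norm (d + s *\<^sub>R p))\<^sup>2"
      unfolding q(3) by (simp add: right_diff_distrib mult_ac)
    then have "\<Phi> (Suc k) \<le> f (y (Suc k)) - f xs + L / (2 * (1 + s)\<^sup>2) * (norm (d + s *\<^sub>R p))\<^sup>2"
      using mixed[of "Suc k" "y (Suc k)"] unfolding e \<Phi>_def by linarith
    then have "(1 + s) * \<Phi> (Suc k) \<le>
        (1 + s) * (f (y (Suc k)) - f xs + L / (2 * (1 + s)\<^sup>2) * (norm (d + s *\<^sub>R p))\<^sup>2)"
      using s by (intro mult_left_mono) auto
    also have "(1 + s) * (L / (2 * (1 + s)\<^sup>2)) = L / (2 * (1 + s))"
      using s by (simp add: power2_eq_square)
    then have "(1 + s) * (f (y (Suc k)) - f xs + L / (2 * (1 + s)\<^sup>2) * (norm (d + s *\<^sub>R p))\<^sup>2) = \<Phi> k"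
      unfolding \<Phi>_def d_def[symmetric] p_def[symmetric]
      by (simp only: distrib_left mult.assoc[symmetric])
    finally show ?thesis .
  qed
  note contract = this
  have "(1 + s) ^ i * \<Phi> (m + i) \<le> ?B" if "m + i \<le> n" for i
    using that
  proof (induction i)
    case 0
    have "0 \<le> s * (\<mu> / 2 * (norm (x m - xs))\<^sup>2)"
      using s mu_pos by simp
    then show ?case
      using mixed[of m "y m"] unfolding \<Phi>_def by simp
  next
    case (Suc i)
    have "(1 + s) ^ i * ((1 + s) * \<Phi> (Suc (m + i))) \<le> (1 + s) ^ i * \<Phi> (m + i)"
      using contract[of "m + i"] Suc.prems s by (intro mult_left_mono) auto
    with Suc show ?case by (simp add: mult_ac)
  qed
  \<comment> \<open>Only \<open>n - Suc m\<close> contractions fit between \<open>\<Phi> m\<close>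
    and \<open>\<Phi> (n - 1)\<close>; the last factor \<open>1 + s\<close> is the weight of the gap
    inside \<open>\<Phi> (n - 1)\<close>.\<close>
  from this[of "n - Suc m"] have "(1 + s) ^ (n - Suc m) * \<Phi> (n - 1) \<le> ?B"
    using \<open>m < n\<close> by simp
  moreover have "(1 + s) ^ (n - Suc m) * ((1 + s) * (f (y n) - f xs))
      \<le> (1 + s) ^ (n - Suc m) * \<Phi> (n - 1)"
    using \<open>m < n\<close> s L_pos unfolding \<Phi>_def by (intro mult_left_mono) auto
  moreover have "(1 + s) ^ (n - m) = (1 + s) ^ (n - Suc m) * (1 + s)"
    using \<open>m < n\<close> by (simp flip: power_Suc2 add: Suc_diff_Suc)
  ultimately show ?thesis
    unfolding s_def[symmetric] by (simp add: mult.assoc)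
qed

text \<open>Price of changing energies at the switch: the slow energy is expanded in
  \<open>x - y\<close> and \<open>y - xs\<close>, Young's inequality removes the mixed term, and
  quadratic growth turns the distance to the minimizer into the gap.\<close>

lemma switch_bound:
  assumes q: "0 < q" "q < 1" "\<mu> = q^4 * L"
  shows "f y - f xs + L / (2 * (1 + q^3)) * (norm ((x - y) + q^3 *\<^sub>R (x - xs)))\<^sup>2
    \<le> (q^3 * (1 + sqrt (L / (2 * \<mu>)))\<^sup>2 + 1) * (f y - f xs + L / 2 * (norm (x - y))\<^sup>2)"
proof -
  define s where "s = q^3"
  define z where "z = sqrt (L / (2 * \<mu>))"
  define u where "u = x - y"
  define p where "p = y - xs"
  define U where "U = L / 2 * (norm u)\<^sup>2"
  define P where "P = L / 2 * (norm p)\<^sup>2"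
  define F where "F = f y - f xs"
  have s: "0 < s" using q by (simp add: s_def)
  have nonneg: "0 \<le> U" "0 \<le> P" "0 \<le> F"
    using L_pos minimum[of y] by (simp_all add: U_def P_def F_def)
  have PF: "q^4 * P \<le> F"
    using quadratic_growth[of y] by (simp add: q(3) P_def F_def p_def mult_ac)
  \<comment> \<open>The weight in Young's inequality is chosen so that
    \<open>s\<^sup>2 / q * P\<close> is \<open>q * (q^4 * P)\<close>, hence at most
    \<open>q * F\<close>.\<close>
  have "0 \<le> L / 2 * (norm (q *\<^sub>R u - s *\<^sub>R p))\<^sup>2 / q" using q L_pos by simp
  also have "\<dots> = q * U - L * s * (u \<bullet> p) + s\<^sup>2 / q * P"
    unfolding U_def P_def power2_norm_eq_inner using q
    by (simp add: inner_diff_left inner_diff_right inner_commute[of p u] power2_eq_square field_simps)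
  finally have cross: "L * s * (u \<bullet> p) \<le> q * U + s\<^sup>2 / q * P" by simp
  have e: "(x - y) + s *\<^sub>R (x - xs) = (1 + s) *\<^sub>R u + s *\<^sub>R p"
    by (simp add: u_def p_def algebra_simps)
  have "L / (2 * (1 + s)) * (norm ((x - y) + s *\<^sub>R (x - xs)))\<^sup>2
      = (1 + s) * U + L * s * (u \<bullet> p) + s\<^sup>2 / (1 + s) * P"
  proof -
    have norm_sq: "(norm ((1 + s) *\<^sub>R u + s *\<^sub>R p))\<^sup>2
        = (1 + s)\<^sup>2 * (norm u)\<^sup>2 + 2 * (1 + s) * s * (u \<bullet> p) + s\<^sup>2 * (norm p)\<^sup>2"
      unfolding power2_norm_eq_inner
      by (simp add: inner_add_left inner_add_right inner_commute[of p u] power2_eq_square algebra_simps)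
    have "L / (2 * r) * (r\<^sup>2 * a + 2 * r * s * b + s\<^sup>2 * c)
        = r * (L / 2 * a) + L * s * b + s\<^sup>2 / r * (L / 2 * c)" if "r \<noteq> 0" for r a b c
      using that by (simp add: power2_eq_square field_simps)
    from this[of "1 + s"] show ?thesis
      using s unfolding e U_def P_def norm_sq by simp
  qed
  also have "\<dots> \<le> (1 + s + q) * U + (s\<^sup>2 / (1 + s) + s\<^sup>2 / q) * P"
    using cross by (simp add: algebra_simps)
  also have "\<dots> \<le> (1 + s + q) * U + (s\<^sup>2 + s\<^sup>2 / q) * P"
    using s nonneg by (intro add_left_mono mult_right_mono add_right_mono) (auto simp: divide_le_eq_1 field_simps)
  also have "(s\<^sup>2 + s\<^sup>2 / q) * P = (q\<^sup>2 + q) * (q^4 * P)"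
    using q unfolding s_def by (simp add: field_simps power_numeral_reduce)
  also have "\<dots> \<le> (q\<^sup>2 + q) * F"
    using PF q by (intro mult_left_mono) auto
  finally have "F + L / (2 * (1 + s)) * (norm ((x - y) + s *\<^sub>R (x - xs)))\<^sup>2
      \<le> (1 + q + q\<^sup>2) * F + (1 + s + q) * U"
    by (simp add: algebra_simps)
  also have "\<dots> \<le> (s * (1 + z)\<^sup>2 + 1) * F + (s * (1 + z)\<^sup>2 + 1) * U"
  proof -
    have z: "0 \<le> z" "z\<^sup>2 = 1 / (2 * q^4)"
      using L_pos mu_pos q by (simp_all add: z_def)
    \<comment> \<open>Rounding \<open>z\<close> down to \<open>1 / (2 * q\<^sup>2)\<close> is enough
      to make \<open>2 * s * z\<close> at least \<open>q\<close>.\<close>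
    have "(1 / (2 * q\<^sup>2))\<^sup>2 \<le> z\<^sup>2"
      using q unfolding z by (simp add: power_mult_distrib field_simps flip: power_mult)
    then have "1 / (2 * q\<^sup>2) \<le> z" using z(1) by (rule power2_le_imp_le)
    then have "2 * s * (1 / (2 * q\<^sup>2)) \<le> 2 * s * z" using s by (intro mult_left_mono) auto
    then have "q \<le> 2 * s * z" using q by (simp add: s_def power_numeral_reduce)
    moreover have "s * z\<^sup>2 = 1 / (2 * q)"
      using q unfolding z s_def by (simp add: power_numeral_reduce)
    moreover have "s * (1 + z)\<^sup>2 + 1 = 1 + s + 2 * s * z + s * z\<^sup>2"
      by (simp add: power2_eq_square algebra_simps)
    ultimately have C: "1 + s + q + 1 / (2 * q) \<le> s * (1 + z)\<^sup>2 + 1" by simp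
    \<comment> \<open>The sum equals 1 - 2 q^3 + 2 q^4, so it encodes
      \<open>q\<^sup>2 \<le> s + 1 / (2 * q)\<close> multiplied by \<open>2 * q\<close>.\<close>
    have "0 \<le> (1 - q)\<^sup>2 * q\<^sup>2 + (1 - q\<^sup>2) + q^4" using q by (simp add: power_le_one)
    then have "q\<^sup>2 * (2 * q) \<le> 1 + q^3 * (2 * q)"
      by (simp add: power2_eq_square power_numeral_reduce algebra_simps)
    then have "q\<^sup>2 \<le> s + 1 / (2 * q)"
      using q unfolding s_def by (simp add: field_simps)
    moreover have "0 \<le> 1 / (2 * q)" using q by simp
    ultimately have "1 + q + q\<^sup>2 \<le> s * (1 + z)\<^sup>2 + 1" "1 + s + q \<le> s * (1 + z)\<^sup>2 + 1"
      using C by linarith+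
    then show ?thesis
      using nonneg by (intro add_mono[OF mult_right_mono mult_right_mono])
  qed
  finally show ?thesis
    unfolding s_def z_def U_def F_def u_def by (simp add: distrib_left)
qed

end

section \<open>Bounds for the estimates and the momentum coefficients\<close>

text \<open>The infinite starting value disappears at the first minimum, so
  \<open>real_of_ereal\<close> loses nothing.\<close>

lemma running_min:
  fixes r :: "nat \<Rightarrow> real"
  assumes "\<And>k. mt k = min (case k of 0 \<Rightarrow> \<infinity> | Suc j \<Rightarrow> mt j) (ereal (r k))"
  shows "mt k = ereal (Min (r ` {..k}))"
proof (induction k)
  case 0
  show ?case using assms[of 0] by simp
next
  case (Suc k)
  have "mt (Suc k) = min (ereal (Min (r ` {..k}))) (ereal (r (Suc k)))"
    using assms[of "Suc k"] by (simp add: Suc)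
  then show ?case
    by (simp add: atMost_Suc min.commute)
qed

lemma momentum_coeff_bounds:
  assumes "0 < L" "0 \<le> a" "0 \<le> b" "a\<^sup>2 * L \<le> t" "t \<le> b\<^sup>2 * L"
  shows "(1 - b) / (1 + b) \<le> (sqrt L - sqrt t) / (sqrt L + sqrt t)"
    and "(sqrt L - sqrt t) / (sqrt L + sqrt t) \<le> (1 - a) / (1 + a)"
proof -
  have t: "0 \<le> t" using assms by (meson mult_nonneg_nonneg less_imp_le order_trans zero_le_power2)
  have eq: "(sqrt L - sqrt t) / (sqrt L + sqrt t) = (1 - sqrt (t / L)) / (1 + sqrt (t / L))"
  proof -
    have "sqrt L - sqrt t = sqrt L * (1 - sqrt (t / L))" "sqrt L + sqrt t = sqrt L * (1 + sqrt (t / L))"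
      using assms by (simp_all add: real_sqrt_divide field_simps)
    then show ?thesis using assms by simp
  qed
  have "a \<le> sqrt (t / L)" "sqrt (t / L) \<le> b"
    using assms by (simp_all add: real_le_rsqrt real_le_lsqrt field_simps)
  then show "(1 - b) / (1 + b) \<le> (sqrt L - sqrt t) / (sqrt L + sqrt t)"
    and "(sqrt L - sqrt t) / (sqrt L + sqrt t) \<le> (1 - a) / (1 + a)"
    unfolding eq using assms t by (auto intro!: momentum_coeff_antimono)
qed

text \<open>Supplies the hypothesis of \<open>fast_phase\<close> on \<open>\<beta>\<close> for
  \<open>c\<close> equal to \<open>q\<^sup>2\<close>.\<close>

lemma momentum_coeff_sq_le:
  fixes q t :: real
  assumes "0 < q" "q < 1" "0 \<le> t" "t \<le> (1 - q) / (1 + q)"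
  shows "t\<^sup>2 \<le> 1 / (1 + q\<^sup>2)"
proof -
  have pos: "0 < 1 + q\<^sup>2" by (simp add: add_pos_nonneg)
  have "t\<^sup>2 \<le> ((1 - q) / (1 + q))\<^sup>2" using assms by (intro power_mono) auto
  also have "\<dots> \<le> 1 / (1 + q\<^sup>2)"
  proof -
    have "0 \<le> 2 * q + 2 * q * (1 - q) + 2 * q^3 + (q\<^sup>2 - q^4)"
      using assms power_decreasing[of 2 4 q] by (intro add_nonneg_nonneg) auto
    then have "(1 - q)\<^sup>2 * (1 + q\<^sup>2) \<le> (1 + q)\<^sup>2"
      by (simp add: power2_eq_square power_numeral_reduce algebra_simps)
    then show ?thesis
      using assms pos by (simp add: power_divide divide_simps)
  qed
  finally show ?thesis .
qed

section \<open>Convergence rates in the three cases\<close>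

theorem proposition9:
  fixes f :: "real ^ 'n \<Rightarrow> real" and \<mu> L f_star :: real and N :: nat
    and x0 x_star :: "real ^ 'n" and x y :: "nat \<Rightarrow> real ^ 'n"
    and mt :: "nat \<Rightarrow> ereal" and \<beta> :: "nat \<Rightarrow> real" and m :: enat
  assumes "0 < \<mu>" and "\<mu> < L"
    and "f \<in> smooth_strongly_convex \<mu> L"
    and "is_arg_min f (\<lambda>_. True) x_star" and "f_star = f x_star"
    and "adaptive_momentum_run L f f_star x0 x y mt \<beta>"
    and "m = switch_index \<mu> L f f_star y N"
  shows "if \<forall>k<N. estimate_defined f f_star y k
    then f (y N) - f_star \<le>
      (case m of
         \<infinity> \<Rightarrow> rho2 \<mu> L ^ N * (f x0 - f_star)
       | enat i \<Rightarrow>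
           if i = 0 then rho1 \<mu> L ^ N *
             (L / 2 * (1 / sqrt (rho1 \<mu> L) - sqrt (rho1 \<mu> L))\<^sup>2 * (norm (x0 - x_star))\<^sup>2
              + f x0 - f_star)
           else switch_const \<mu> L * rho1 \<mu> L ^ (N - i) * rho2 \<mu> L ^ i * (f x0 - f_star))
    else \<exists>k\<le>N. (\<forall>i. i + 2 \<le> k \<longrightarrow> estimate_defined f f_star y i) \<and> gradient f (y k) = 0"
proof -
  interpret smooth_convex_gradient f "gradient f" \<mu> L x_star
    using assms(1-4)
    by unfold_locales (auto simp: smooth_strongly_convex_def is_arg_min_def not_less)
  define q where "q = (\<mu> / L) powr (1 / 4)"
  define s where "s = q^3"
  define r where "r k = grad_gap_ratio f f_star (y (Suc k))" for k
  have pow: "q ^ n = (\<mu> / L) powr (real n / 4)" if "n > 0" for n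
    using that mu_pos L_pos unfolding q_def by (simp add: powr_power)
  have q: "0 < q" "q < 1" "\<mu> = q^4 * L"
    using mu_pos mu_less pow[of 4] by (simp_all add: q_def powr01_less_one)
  have s: "0 < s" using q by (simp add: s_def)
  have rho1: "rho1 \<mu> L = 1 / (1 + s)"
    unfolding rho1_def s_def using pow[of 3] by (simp add: inverse_eq_divide)
  have rho2: "rho2 \<mu> L = 1 / (1 + q\<^sup>2)"
    unfolding rho2_def using pow[of 2] mu_pos L_pos by (simp add: inverse_eq_divide powr_half_sqrt)
  have "L * \<mu> = (q\<^sup>2 * L)\<^sup>2"
    by (simp add: q(3) power2_eq_square power_numeral_reduce)
  then have threshold: "sqrt (L * \<mu>) = q\<^sup>2 * L" using L_pos by simp
  have run: "x 0 = x0" "y 0 = x0" "y (Suc k) = x k - (1 / L) *\<^sub>R gradient f (x k)"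
    "mt k = min (case k of 0 \<Rightarrow> \<infinity> | Suc j \<Rightarrow> mt j) (ereal (r k))"
    "\<beta> k = (sqrt L - sqrt (real_of_ereal (mt k))) / (sqrt L + sqrt (real_of_ereal (mt k)))"
    "x (Suc k) = y (Suc k) + \<beta> k *\<^sub>R (y (Suc k) - y k)" for k
    using assms(6) unfolding adaptive_momentum_run_def r_def by blast+
  define \<tau> where "\<tau> k = Min (r ` {..k})" for k
  have \<beta>_eq: "\<beta> k = (sqrt L - sqrt (\<tau> k)) / (sqrt L + sqrt (\<tau> k))" for k
    unfolding run(5) running_min[of mt, OF run(4)] \<tau>_def by simp
  have rate: "a \<le> (1 / c) ^ n * b" if "0 < c" "c ^ n * a \<le> b" for n and a b c :: real
    using that by (simp add: power_divide pos_le_divide_eq mult.commute)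
  have pos2: "0 < 1 + q\<^sup>2" by (simp add: add_pos_nonneg)
  show ?thesis
  proof (cases "\<forall>k<N. estimate_defined f f_star y k")
    case False
    then obtain k' where k': "k' < N" "f (y (Suc k')) = f_star"
      unfolding estimate_defined_def by (auto intro: le_less_trans)
    \<comment> \<open>With the least index, \<open>y (Suc k)\<close> depends only on well-defined
      estimates and not on the convention for division by zero.\<close>
    define k where "k = (LEAST k. f (y (Suc k)) = f_star)"
    have k: "f (y (Suc k)) = f_star" "k < N"
      unfolding k_def
      using LeastI[of "\<lambda>k. f (y (Suc k)) = f_star", OF k'(2)]
        Least_le[of "\<lambda>k. f (y (Suc k)) = f_star", OF k'(2)] k'(1) by simp_all
    have least: "f (y (Suc i)) \<noteq> f_star" if "i < k" for i
      using not_less_Least[of i] that unfolding k_def by blast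
    have "gradient f (y (Suc k)) = 0"
      using grad_sq_le_gap[of "y (Suc k)"] k assms(5) by simp
    moreover have "\<forall>i. i + 2 \<le> Suc k \<longrightarrow> estimate_defined f f_star y i"
      using least unfolding estimate_defined_def by auto
    ultimately show ?thesis
      unfolding if_not_P[OF False] using k(2) by (intro exI[of _ "Suc k"]) simp
  next
    case True
    have gap: "0 < f (y (Suc k)) - f x_star" if "k < N" for k
    proof -
      have "f (y (Suc k)) \<noteq> f x_star"
        using True that assms(5) unfolding estimate_defined_def by auto
      with minimum[of "y (Suc k)"] show ?thesis by simp
    qed
    have r_bounds: "\<mu> \<le> r k" "r k \<le> L" if "k < N" for k
      using gap[OF that] gap_le_grad_sq[of "y (Suc k)"] grad_sq_le_gap[of "y (Suc k)"]
      unfolding r_def grad_gap_ratio_def assms(5) by (simp_all add: field_simps)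
    have \<tau>_le: "\<tau> k \<le> r i" if "i \<le> k" for i k
      unfolding \<tau>_def using that by simp
    have \<tau>_ge: "c \<le> \<tau> k" if "\<And>i. i \<le> k \<Longrightarrow> c \<le> r i" for c k
      unfolding \<tau>_def using that by simp
    have fast: "(1 + q\<^sup>2) ^ n * (f (y n) - f_star + L / 2 * (norm (x n - y n))\<^sup>2) \<le> f x0 - f_star"
      if n: "n \<le> N" "\<And>k. k < n \<Longrightarrow> q\<^sup>2 * L \<le> r k" for n
    proof -
      have "(\<beta> k)\<^sup>2 \<le> 1 / (1 + q\<^sup>2)" if "k < n" for k
      proof (rule momentum_coeff_sq_le[OF q(1,2)])
        \<comment> \<open>The factor \<open>1\<^sup>2\<close> fits the form of
          \<open>momentum_coeff_bounds\<close>, whose lower bound then reads 0.\<close>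
        have "q\<^sup>2 * L \<le> \<tau> k" "\<tau> k \<le> 1\<^sup>2 * L"
          using that n \<tau>_ge \<tau>_le[of 0 k] r_bounds(2)[of 0] by (force, simp)
        from momentum_coeff_bounds[OF L_pos _ _ this] q
        show "0 \<le> \<beta> k" "\<beta> k \<le> (1 - q) / (1 + q)" unfolding \<beta>_eq by simp_all
      qed
      moreover have "2 * (q\<^sup>2 * L) * (f (y (Suc k)) - f x_star) \<le> (norm (gradient f (y (Suc k))))\<^sup>2"
        if "k < n" for k
        using n(2)[OF that] gap[of k] that n(1)
        unfolding r_def grad_gap_ratio_def assms(5) by (simp add: field_simps)
      ultimately show ?thesis
        using fast_phase[of "q\<^sup>2" x y \<beta> n] run unfolding assms(5) by simp
    qed
    show ?thesis
    proof (cases "\<exists>k<N. r k \<le> q\<^sup>2 * L")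
      case none: False
      then have m: "m = \<infinity>"
        unfolding assms(7) switch_index_def threshold r_def by auto
      have "(1 + q\<^sup>2) ^ N * (f (y N) - f_star) \<le>
          (1 + q\<^sup>2) ^ N * (f (y N) - f_star + L / 2 * (norm (x N - y N))\<^sup>2)"
        using L_pos by (intro mult_left_mono) auto
      also have "\<dots> \<le> f x0 - f_star"
        using none by (intro fast) auto
      finally have "f (y N) - f_star \<le> rho2 \<mu> L ^ N * (f x0 - f_star)"
        unfolding rho2 by (rule rate[OF pos2])
      then show ?thesis
        using True m by simp
    next
      case some: True
      define i where "i = (LEAST k. r k \<le> q\<^sup>2 * L)"
      have m: "m = enat i"
        using some unfolding assms(7) switch_index_def threshold i_def r_def by auto
      \<comment> \<open>The least index ranges over all naturals; the witness from
        \<open>some\<close> places it below \<open>N\<close>.\<close>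
      have i: "r i \<le> q\<^sup>2 * L" "i < N"
        using some LeastI[of "\<lambda>k. r k \<le> q\<^sup>2 * L"] Least_le[of "\<lambda>k. r k \<le> q\<^sup>2 * L"]
        unfolding i_def by (blast, meson le_less_trans)
      have before: "q\<^sup>2 * L \<le> r k" if "k < i" for k
        using not_less_Least[of k "\<lambda>k. r k \<le> q\<^sup>2 * L"] that unfolding i_def by simp
      have \<beta>_slow: "(1 - q) / (1 + q) \<le> \<beta> k \<and> \<beta> k \<le> (1 - q\<^sup>2) / (1 + q\<^sup>2)" if "i \<le> k" "k < N" for k
      proof -
        \<comment> \<open>The lower bound is \<open>\<mu>\<close>. The upper bound persists after
          the switch, even if later ratios grow, because the running minimum retains
          \<open>r i\<close>.\<close>
        have "(q\<^sup>2)\<^sup>2 * L \<le> \<tau> k" "\<tau> k \<le> q\<^sup>2 * L"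
          using that \<tau>_ge[of k \<mu>] \<tau>_le[of i k] i(1) r_bounds(1) q(3) by auto
        from momentum_coeff_bounds[OF L_pos _ _ this] q show ?thesis unfolding \<beta>_eq by simp
      qed
      define B where "B = f (y i) - f_star
        + L / (2 * (1 + s)) * (norm ((x i - y i) + s *\<^sub>R (x i - x_star)))\<^sup>2"
      have "(1 + s) ^ (N - i) * (f (y N) - f_star) \<le> B"
        using slow_phase[where x = x and y = y and \<beta> = \<beta>, OF q \<open>i < N\<close> run(3) run(6) \<beta>_slow]
        unfolding B_def s_def assms(5) .
      then have slow: "f (y N) - f_star \<le> rho1 \<mu> L ^ (N - i) * B"
        unfolding rho1 using s by (intro rate) auto
      show ?thesis
      proof (cases "i = 0")
        case True
        \<comment> \<open>For \<open>i = 0\<close> the term \<open>x 0 - y 0\<close> vanishes, so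
          the norm in \<open>B\<close> is \<open>s\<close> times the initial distance; this identity
          recovers the stated coefficient.\<close>
        have "(1 / sqrt (1 / (1 + s)) - sqrt (1 / (1 + s)))\<^sup>2 = s\<^sup>2 / (1 + s)"
          using s by (simp add: real_sqrt_divide power2_diff power_divide field_simps power2_eq_square)
        then have "B = L / 2 * (1 / sqrt (rho1 \<mu> L) - sqrt (rho1 \<mu> L))\<^sup>2 * (norm (x0 - x_star))\<^sup>2
            + f x0 - f_star"
          using s unfolding B_def rho1 True run(1,2) by (simp add: power_mult_distrib)
        then show ?thesis
          using slow True m \<open>\<forall>k<N. estimate_defined f f_star y k\<close> by simp
      next
        case False
        have C: "switch_const \<mu> L = s * (1 + sqrt (L / (2 * \<mu>)))\<^sup>2 + 1"
          unfolding switch_const_def rho1 by simp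
        have "f (y i) - f_star + L / 2 * (norm (x i - y i))\<^sup>2 \<le> rho2 \<mu> L ^ i * (f x0 - f_star)"
          using fast[of i] before \<open>i < N\<close> unfolding rho2 by (intro rate pos2) auto
        then have "switch_const \<mu> L * (f (y i) - f_star + L / 2 * (norm (x i - y i))\<^sup>2)
            \<le> switch_const \<mu> L * (rho2 \<mu> L ^ i * (f x0 - f_star))"
          using s unfolding C by (intro mult_left_mono) auto
        moreover have "B \<le> switch_const \<mu> L * (f (y i) - f_star + L / 2 * (norm (x i - y i))\<^sup>2)"
          unfolding B_def C s_def assms(5) by (rule switch_bound[OF q])
        ultimately have "B \<le> switch_const \<mu> L * (rho2 \<mu> L ^ i * (f x0 - f_star))"
          by linarith
        then have "rho1 \<mu> L ^ (N - i) * B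
            \<le> rho1 \<mu> L ^ (N - i) * (switch_const \<mu> L * (rho2 \<mu> L ^ i * (f x0 - f_star)))"
          using s unfolding rho1 by (intro mult_left_mono) auto
        then show ?thesis
          using slow False m True by (simp add: mult_ac)
      qed
    qed
  qed
qed

end
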